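(* For all $\xi\in\mathbb{R}^{m\times n}$, $$h^{\mathrm{qc},\infty}(\xi)=\ell\,(\Psi^{1/2})^{\mathrm{qc},\infty}(\xi).$$
   Context: $m,n\ge1$ are integers, $\ell>0$; $|\cdot|$ is the Euclidean (Frobenius) norm. $\Psi:\mathbb{R}^{m\times n}\to[0,\infty)$ is continuous and there is $c\ge1$ with $\max\{\frac1c|\xi|^2-c,0\}\le\Psi(\xi)\le c(|\xi|^2+1)$ for all $\xi$; the limit $\Psi_\infty(\xi):=\lim_{t\to\infty}\Psi(t\xi)/t^2$ is assumed to exist, uniformly on $\{|\xi|=1\}$. $h(\xi):=\min\{\Psi(\xi),\ell\Psi^{1/2}(\xi)\}$. For $\phi:\mathbb{R}^{m\times n}\to[0,\infty)$ continuous, $\phi^{\mathrm{qc}}(\xi):=\inf\{\int_{(0,1)^n}\phi(\xi+\nabla\varphi)\,dx:\varphi\in C_c^\infty((0,1)^n;\mathbb{R}^m)\}$ and $\phi^{\mathrm{qc},\infty}(\xi):=\limsup_{t\to\infty}\phi^{\mathrm{qc}}(t\xi)/t$. *)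

theory Defs
  imports "HOL-Analysis.Analysis"
begin

text \<open>
  \<open>Ck_smooth k f\<close>: \<open>f\<close> is \<open>k\<close> times continuously differentiable on the whole space. The
  derivative is tested in every fixed direction \<open>v\<close>, so that the iterated derivatives
  keep the type of \<open>f\<close>.
\<close>

primrec Ck_smooth :: "nat \<Rightarrow> ('a::euclidean_space \<Rightarrow> 'b::real_normed_vector) \<Rightarrow> bool" where
  "Ck_smooth 0 f \<longleftrightarrow> continuous_on UNIV f"
| "Ck_smooth (Suc k) f \<longleftrightarrow>
     (\<forall>x. f differentiable (at x)) \<and> (\<forall>v. Ck_smooth k (\<lambda>x. frechet_derivative f (at x) v))"

text \<open>
  \<open>C\<^sub>c\<^sup>\<infinity>(U)\<close> for open \<open>U\<close>, its members being identified with their extensions by zero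
  to the whole space.
\<close>

definition test_functions :: "'a::euclidean_space set \<Rightarrow> ('a \<Rightarrow> 'b::real_normed_vector) set" where
  "test_functions U = {f. (\<forall>k. Ck_smooth k f) \<and>
     compact (closure (support_on UNIV f)) \<and> closure (support_on UNIV f) \<subseteq> U}"

abbreviation unit_cube :: "(real ^ 'n) set" where
  "unit_cube \<equiv> {x. \<forall>i. 0 < x $ i \<and> x $ i < 1}"

text \<open>
  An \<open>m \<times> n\<close> matrix has type \<^typ>\<open>real ^ 'n ^ 'm\<close>, whose \<^const>\<open>norm\<close> is the Frobenius norm;
  \<^term>\<open>jacobian \<phi> (at x) $ i $ j\<close> is the \<open>j\<close>-th partial derivative of the \<open>i\<close>-th component
  of \<open>\<phi>\<close>. For continuous nonnegative \<open>f\<close> the integrals exist and are bounded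
  below by \<open>0\<close>, and \<open>\<phi> = 0\<close> is admissible, so the real infimum is the true one.
\<close>

definition qc_env :: "(real ^ 'n ^ 'm \<Rightarrow> real) \<Rightarrow> real ^ 'n ^ 'm \<Rightarrow> real" where
  "qc_env f \<xi> =
     (INF \<phi> \<in> (test_functions unit_cube :: (real ^ 'n \<Rightarrow> real ^ 'm) set).
        LINT x:unit_cube|lborel. f (\<xi> + jacobian \<phi> (at x)))"

text \<open>The upper limit is taken in the extended reals, where it always exists.\<close>

definition qc_recession :: "(real ^ 'n ^ 'm \<Rightarrow> real) \<Rightarrow> real ^ 'n ^ 'm \<Rightarrow> ereal" where
  "qc_recession f \<xi> = Limsup at_top (\<lambda>t::real. ereal (qc_env f (t *\<^sub>R \<xi>) / t))"

definition trunc_density ::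
    "real \<Rightarrow> (real ^ 'n ^ 'm \<Rightarrow> real) \<Rightarrow> real ^ 'n ^ 'm \<Rightarrow> real" where
  "trunc_density l \<Psi> \<xi> = min (\<Psi> \<xi>) (l * sqrt (\<Psi> \<xi>))"

end

theory Submission
  imports Defs
begin

text \<open>
  Since \<open>l s - s\<^sup>2 \<le> l\<^sup>2 / 4\<close>, the densities \<open>trunc_density l \<Psi>\<close> and \<open>l \<surd>\<Psi>\<close> differ by at most
  \<open>l\<^sup>2 / 4\<close>. The cube has volume 1, so their quasiconvex envelopes differ by at most the same
  constant, which disappears after division by \<open>t \<rightarrow> \<infinity>\<close>.
\<close>

lemma Ck_smooth_zero: "Ck_smooth k (\<lambda>_. 0)"
  by (induction k) (simp_all add: frechet_derivative_const)

text \<open>Ensures that the infimum in \<open>qc_env\<close> runs over a nonempty set, as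
  \<open>cINF_greatest\<close> requires.\<close>

lemma zero_in_test_functions: "(\<lambda>_. 0) \<in> test_functions U"
  by (simp add: test_functions_def Ck_smooth_zero support_on_def)

text \<open>Each entry is a component of the derivative in a fixed axis direction, and
  \<open>Ck_smooth 1\<close> gives continuity direction by direction.\<close>

lemma continuous_jacobian:
  fixes \<phi> :: "real ^ 'n \<Rightarrow> real ^ 'm"
  assumes "Ck_smooth 1 \<phi>"
  shows "continuous_on UNIV (\<lambda>x. jacobian \<phi> (at x))"
proof -
  have "continuous_on UNIV (\<lambda>x. frechet_derivative \<phi> (at x) v)" for v
    using assms by simp
  then show ?thesis
    unfolding jacobian_def matrix_def
    by (intro continuous_on_vec_lambda continuous_on_component)
qed

lemma unit_cube_eq_box: "(unit_cube :: (real ^ 'n) set) = box 0 1"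
  by (auto simp: mem_box_cart)

lemma measure_unit_cube: "measure lborel (unit_cube :: (real ^ 'n) set) = 1"
  unfolding unit_cube_eq_box
  by (subst measure_lborel_box_eq) (auto simp: Basis_vec_def inner_axis intro!: prod.neutral)

text \<open>The open cube is not compact, so integrability is first obtained on the closed cube and
  then restricted.\<close>

lemma set_integrable_unit_cube:
  fixes f :: "real ^ 'n \<Rightarrow> real"
  assumes "continuous_on UNIV f"
  shows "set_integrable lborel unit_cube f"
proof (rule set_integrable_subset)
  show "set_integrable lborel (cbox 0 1) f"
    using assms unfolding set_integrable_def
    by (intro borel_integrable_compact) (auto intro: continuous_on_subset)
  show "unit_cube \<subseteq> (cbox 0 1 :: (real ^ 'n) set)"
    by (auto simp: mem_box_cart less_imp_le)
  show "(unit_cube :: (real ^ 'n) set) \<in> sets lborel"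
    unfolding unit_cube_eq_box by simp
qed

lemma set_integrable_qc_integrand:
  fixes f :: "real ^ 'n ^ 'm \<Rightarrow> real"
  assumes "continuous_on UNIV f" "\<phi> \<in> test_functions unit_cube"
  shows "set_integrable lborel unit_cube (\<lambda>x. f (\<xi> + jacobian \<phi> (at x)))"
proof (rule set_integrable_unit_cube)
  have "Ck_smooth 1 \<phi>"
    using assms(2) unfolding test_functions_def by blast
  then show "continuous_on UNIV (\<lambda>x. f (\<xi> + jacobian \<phi> (at x)))"
    by (intro continuous_on_compose2[OF assms(1)] continuous_intros continuous_jacobian) auto
qed

text \<open>Nonnegativity bounds all the competing integrals below by 0, so the real infimum is a
  genuine lower bound.\<close>

lemma qc_env_le_integral:
  fixes f :: "real ^ 'n ^ 'm \<Rightarrow> real"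
  assumes "\<And>\<eta>. 0 \<le> f \<eta>" "\<phi> \<in> test_functions unit_cube"
  shows "qc_env f \<xi> \<le> (LINT x:unit_cube|lborel. f (\<xi> + jacobian \<phi> (at x)))"
  unfolding qc_env_def
proof (rule cINF_lower)
  show "bdd_below ((\<lambda>\<phi>. LINT x:unit_cube|lborel. f (\<xi> + jacobian \<phi> (at x))) ` 
      test_functions unit_cube)"
    using assms(1)
    by (intro bdd_belowI2[where m = 0])
       (auto simp: set_lebesgue_integral_def intro!: Bochner_Integration.integral_nonneg)
qed (fact assms(2))

text \<open>The pointwise bound is integrated for each test function; since the cube has volume 1,
  the constant contributes exactly \<open>b\<close>.\<close>

lemma qc_env_le_affine:
  fixes f g :: "real ^ 'n ^ 'm \<Rightarrow> real"
  assumes f: "continuous_on UNIV f" "\<And>\<eta>. 0 \<le> f \<eta>"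
    and g: "continuous_on UNIV g"
    and a: "0 < a"
    and le: "\<And>\<eta>. f \<eta> \<le> a * g \<eta> + b"
  shows "qc_env f \<xi> \<le> a * qc_env g \<xi> + b"
proof -
  \<comment> \<open>Solving for the integral of \<open>g\<close> gives a lower bound independent of
    \<open>\<phi>\<close>, which therefore passes to the infimum defining
    \<open>qc_env g \<xi>\<close>.\<close>
  have "(qc_env f \<xi> - b) / a \<le> (LINT x:unit_cube|lborel. g (\<xi> + jacobian \<phi> (at x)))"
    if \<phi>: "\<phi> \<in> test_functions unit_cube" for \<phi>
  proof -
    note intf = set_integrable_qc_integrand[OF f(1) \<phi>, of \<xi>]
    note intg = set_integrable_qc_integrand[OF g \<phi>, of \<xi>]
    have intb: "set_integrable lborel (unit_cube :: (real ^ 'n) set) (\<lambda>_. b)"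
      by (intro set_integrable_unit_cube continuous_on_const)
    have "qc_env f \<xi> \<le> (LINT x:unit_cube|lborel. f (\<xi> + jacobian \<phi> (at x)))"
      by (rule qc_env_le_integral[OF f(2) \<phi>])
    also have "\<dots> \<le> (LINT x:unit_cube|lborel. a * g (\<xi> + jacobian \<phi> (at x)) + b)"
      using intf intg intb le by (intro set_integral_mono set_integral_add) auto
    also have "\<dots> = a * (LINT x:unit_cube|lborel. g (\<xi> + jacobian \<phi> (at x)))
        + (LINT x:(unit_cube :: (real ^ 'n) set)|lborel. b)"
      using intg intb by (subst set_integral_add) auto
    also have "(LINT x:(unit_cube :: (real ^ 'n) set)|lborel. b) = b"
      using measure_unit_cube[where 'n = 'n] unfolding set_lebesgue_integral_def by simp
    finally show ?thesis
      using a by (simp add: field_simps)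
  qed
  then have "(qc_env f \<xi> - b) / a \<le> qc_env g \<xi>"
    unfolding qc_env_def[of g] using zero_in_test_functions by (intro cINF_greatest) auto
  then show ?thesis
    using a by (simp add: field_simps)
qed

text \<open>Eventually \<open>e\<close> stays below any given \<open>\<epsilon> > 0\<close>. A
  finite constant can be pulled out of an upper limit even when that limit is infinite, and
  \<open>\<epsilon>\<close> is arbitrary.\<close>

lemma Limsup_ereal_add_vanishing_le:
  fixes u v e :: "'a \<Rightarrow> real"
  assumes nontriv: "F \<noteq> bot" and e: "(e \<longlongrightarrow> 0) F"
    and le: "\<forall>\<^sub>F t in F. u t \<le> v t + e t"
  shows "Limsup F (\<lambda>t. ereal (u t)) \<le> Limsup F (\<lambda>t. ereal (v t))"
proof (rule ereal_le_epsilon2)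
  fix \<epsilon> :: real assume "0 < \<epsilon>"
  then have "\<forall>\<^sub>F t in F. e t < \<epsilon>"
    using e by (rule order_tendstoD(2)[rotated])
  then have "\<forall>\<^sub>F t in F. ereal (u t) \<le> ereal (v t) + ereal \<epsilon>"
    using le by eventually_elim simp
  then have "Limsup F (\<lambda>t. ereal (u t)) \<le> Limsup F (\<lambda>t. ereal (v t) + ereal \<epsilon>)"
    by (rule Limsup_mono)
  also have "\<dots> = Limsup F (\<lambda>t. ereal (v t)) + ereal \<epsilon>"
    using nontriv by (rule Limsup_add_ereal_right) simp
  finally show "Limsup F (\<lambda>t. ereal (u t)) \<le> Limsup F (\<lambda>t. ereal (v t)) + ereal \<epsilon>" .
qed

text \<open>Dividing the envelope bound at \<open>t *\<^sub>R \<xi>\<close> by \<open>t\<close>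
  turns the additive constant into \<open>b / t\<close>, which vanishes at infinity; the positive
  factor \<open>a\<close> comes out of the upper limit.\<close>

lemma qc_recession_le_affine:
  fixes f g :: "real ^ 'n ^ 'm \<Rightarrow> real"
  assumes "continuous_on UNIV f" "\<And>\<eta>. 0 \<le> f \<eta>" "continuous_on UNIV g"
    and a: "0 < a" and "\<And>\<eta>. f \<eta> \<le> a * g \<eta> + b"
  shows "qc_recession f \<xi> \<le> ereal a * qc_recession g \<xi>"
proof -
  have "qc_env f (t *\<^sub>R \<xi>) / t \<le> a * (qc_env g (t *\<^sub>R \<xi>) / t) + b / t" if "0 < t" for t
    using qc_env_le_affine[OF assms, of "t *\<^sub>R \<xi>"] that by (simp add: field_simps)
  then have "\<forall>\<^sub>F t in at_top. qc_env f (t *\<^sub>R \<xi>) / t \<le> a * (qc_env g (t *\<^sub>R \<xi>) / t) + b / t"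
    using eventually_gt_at_top[of 0] by (rule eventually_mono[rotated])
  moreover have "((\<lambda>t::real. b / t) \<longlongrightarrow> 0) at_top"
    by (intro tendsto_divide_0[OF tendsto_const] filterlim_at_top_imp_at_infinity filterlim_ident)
  ultimately have "qc_recession f \<xi>
      \<le> Limsup at_top (\<lambda>t::real. ereal (a * (qc_env g (t *\<^sub>R \<xi>) / t)))"
    unfolding qc_recession_def by (intro Limsup_ereal_add_vanishing_le) auto
  also have "\<dots> = ereal a * qc_recession g \<xi>"
    unfolding qc_recession_def times_ereal.simps(1)[symmetric]
    using a by (intro Limsup_ereal_mult_left) auto
  finally show ?thesis .
qed

lemma trunc_density_le: "trunc_density l \<Psi> \<xi> \<le> l * sqrt (\<Psi> \<xi>)"
  by (simp add: trunc_density_def)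

text \<open>Completing the square handles the branch \<open>\<Psi> \<xi>\<close> of the minimum; the
  other branch only needs \<open>l\<^sup>2 / 4\<close> to be nonnegative.\<close>

lemma trunc_density_ge:
  assumes "0 \<le> \<Psi> \<xi>"
  shows "l * sqrt (\<Psi> \<xi>) \<le> trunc_density l \<Psi> \<xi> + l\<^sup>2 / 4"
proof -
  have "0 \<le> (sqrt (\<Psi> \<xi>) - l / 2)\<^sup>2"
    by simp
  then have "l * sqrt (\<Psi> \<xi>) \<le> \<Psi> \<xi> + l\<^sup>2 / 4"
    using assms by (simp add: power2_diff power_divide field_simps)
  then show ?thesis
    by (simp add: trunc_density_def min_def)
qed

theorem proposition3p10:
  fixes \<Psi> \<Psi>_inf :: "real ^ 'n ^ 'm \<Rightarrow> real"
    and l c :: real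
  assumes l_pos: "l > 0"
    and cont: "continuous_on UNIV \<Psi>"
    and nonneg: "\<And>\<xi>. \<Psi> \<xi> \<ge> 0"
    and c_ge_1: "c \<ge> 1"
    and lower: "\<And>\<xi>. max (1 / c * (norm \<xi>)\<^sup>2 - c) 0 \<le> \<Psi> \<xi>"
    and upper: "\<And>\<xi>. \<Psi> \<xi> \<le> c * ((norm \<xi>)\<^sup>2 + 1)"
    and limit: "\<And>\<xi>. ((\<lambda>t::real. \<Psi> (t *\<^sub>R \<xi>) / t\<^sup>2) \<longlongrightarrow> \<Psi>_inf \<xi>) at_top"
    and limit_unif: "uniform_limit {\<xi>. norm \<xi> = 1} (\<lambda>(t::real) \<xi>. \<Psi> (t *\<^sub>R \<xi>) / t\<^sup>2) \<Psi>_inf at_top"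
  shows "\<forall>\<xi>. qc_recession (trunc_density l \<Psi>) \<xi>
           = ereal l * qc_recession (\<lambda>\<eta>. sqrt (\<Psi> \<eta>)) \<xi>"
proof
  fix \<xi> :: "real ^ 'n ^ 'm"
  let ?h = "trunc_density l \<Psi>" and ?s = "\<lambda>\<eta>. sqrt (\<Psi> \<eta>)"
  have cont_s: "continuous_on UNIV ?s"
    using cont by (intro continuous_intros)
  have cont_h: "continuous_on UNIV ?h"
    unfolding trunc_density_def using cont by (intro continuous_intros)
  have h_nonneg: "0 \<le> ?h \<eta>" for \<eta>
    using nonneg[of \<eta>] l_pos by (simp add: trunc_density_def)
  \<comment> \<open>This is \<open>trunc_density_ge\<close> divided by \<open>l\<close>, the affine
    form with \<open>a = 1 / l\<close> and \<open>b = l / 4\<close>.\<close>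
  have s_le: "?s \<eta> \<le> (1 / l) * ?h \<eta> + l / 4" for \<eta>
    using trunc_density_ge[of \<Psi> \<eta> l] nonneg l_pos by (simp add: field_simps power2_eq_square)
  show "qc_recession ?h \<xi> = ereal l * qc_recession ?s \<xi>"
  proof (rule antisym)
    show "qc_recession ?h \<xi> \<le> ereal l * qc_recession ?s \<xi>"
      using trunc_density_le
      by (intro qc_recession_le_affine[where b = 0] cont_h h_nonneg cont_s l_pos) simp
    have "qc_recession ?s \<xi> \<le> ereal (1 / l) * qc_recession ?h \<xi>"
      using nonneg l_pos by (intro qc_recession_le_affine[OF cont_s _ cont_h _ s_le]) auto
    then have "ereal l * qc_recession ?s \<xi> \<le> ereal l * (ereal (1 / l) * qc_recession ?h \<xi>)"
      using l_pos by (intro ereal_mult_left_mono) auto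
    \<comment> \<open>The finite factors \<open>l\<close> and \<open>1 / l\<close> are multiplied
      first, so the cancellation is valid even if the recession value is infinite.\<close>
    also have "\<dots> = qc_recession ?h \<xi>"
      using l_pos by (simp flip: mult.assoc add: one_ereal_def[symmetric])
    finally show "ereal l * qc_recession ?s \<xi> \<le> qc_recession ?h \<xi>" .
  qed
qed

end
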